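(* (a) Let $m\ge 2$, $n\ge 2$ and let $A=(a_{ij})\in\mathbb{R}^{m\times n}$ satisfy: (i) the matrix $\overline{A}\in\mathbb{R}^{(m-1)\times n}$ formed by the first $m-1$ rows of $A$ is column uniform; (ii) no column of $A$ is uniform; (iii) $a_{mj}=0$ for all $j\in\{1,\dots,n\}$. For each $j$ let $f_j$ be the common value of $fr(a_{ij})$, $i=1,\dots,m-1$. For $k\in\{1,\dots,n\}$ let $B^{(k)}\in\mathbb{R}^{(m-1)\times(n-1)}$ be the matrix obtained from $\overline{A}$ by deleting its $k$-th column $\overline{A}_k$, and let $F^{(k)}=(f_1,\dots,f_{k-1},f_{k+1},\dots,f_n)^T$. Then there exists $x\in\mathbb{R}^n$ with $A\otimes x\in\mathbb{Z}^m$ if and only if for at least one $k\in\{1,\dots,n\}$ $$B^{(k)}\otimes(-F^{(k)})\ \ge\ \overline{A}_k .$$ Moreover, if this inequality holds for some $k$, then the vector $x=-(f_1,\dots,f_{k-1},0,f_{k+1},\dots,f_n)^T$ satisfies $A\otimes x\in\mathbb{Z}^m$, and $A\otimes x$ is the vector $B^{(k)}\otimes(-F^{(k)})$ extended by $0$ in the $m$-th component. (b) There is an algorithm which, given any almost column uniform matrix $A\in\mathbb{R}^{m\times n}$, performs $O(mn^2)$ elementary operations and either outputs an $x\in\mathbb{R}^n$ with $A\otimes x\in\mathbb{Z}^m$, or correctly reports that no such $x$ exists.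
   Context: For $A=(a_{ij})\in\mathbb{R}^{m\times n}$ and $x\in\mathbb{R}^n$ the max-plus product $A\otimes x\in\mathbb{R}^m$ is defined by $(A\otimes x)_i=\max_{1\le j\le n}(a_{ij}+x_j)$. Vector inequalities are componentwise, and $-v$ denotes the ordinary componentwise negative. The fractional part of a real number $a$ is $fr(a)=a-\lfloor a\rfloor\in[0,1)$. A real vector is called uniform if all its components have the same fractional part; a real matrix is called column uniform if each of its columns is uniform. A matrix $A\in\mathbb{R}^{m\times n}$ (with $m\ge2$) is called almost column uniform if the matrix obtained by removing some one row of $A$ is column uniform. Elementary operations are exact operations on real numbers, each counted at unit cost: addition, subtraction, comparison (hence maximum and minimum), and the floor and ceiling functions. *)

theory Defs
  imports Complex_Main "Jordan_Normal_Form.Matrix"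
begin

section \<open>Max-plus matrices\<close>

text \<open>
  Matrices and vectors of arbitrary size are those of the Jordan normal form library, so rows and
  columns are numbered from 0; \<open>\<le>\<close> and unary minus on vectors are componentwise there.
  The maximum below is meaningful only if there is at least one column.
\<close>

definition mp_mult :: "real mat \<Rightarrow> real vec \<Rightarrow> real vec" (infixl "\<otimes>\<^sub>m\<^sub>p" 70) where
  "A \<otimes>\<^sub>m\<^sub>p x = vec (dim_row A) (\<lambda>i. Max ((\<lambda>j. A $$ (i, j) + x $ j) ` {..<dim_col A}))"

definition integer_vec :: "real vec \<Rightarrow> bool" where
  "integer_vec v \<longleftrightarrow> (\<forall>i<dim_vec v. v $ i \<in> \<int>)"

definition skip_index :: "nat \<Rightarrow> nat \<Rightarrow> nat" where
  "skip_index k i = (if i < k then i else Suc i)"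

definition del_row :: "real mat \<Rightarrow> nat \<Rightarrow> real mat" where
  "del_row A k = mat (dim_row A - 1) (dim_col A) (\<lambda>(i, j). A $$ (skip_index k i, j))"

definition del_col :: "real mat \<Rightarrow> nat \<Rightarrow> real mat" where
  "del_col A k = mat (dim_row A) (dim_col A - 1) (\<lambda>(i, j). A $$ (i, skip_index k j))"

definition del_entry :: "real vec \<Rightarrow> nat \<Rightarrow> real vec" where
  "del_entry v k = vec (dim_vec v - 1) (\<lambda>j. v $ skip_index k j)"

definition uniform_vec :: "real vec \<Rightarrow> bool" where
  "uniform_vec v \<longleftrightarrow> (\<forall>i<dim_vec v. \<forall>i'<dim_vec v. frac (v $ i) = frac (v $ i'))"

definition column_uniform :: "real mat \<Rightarrow> bool" where
  "column_uniform A \<longleftrightarrow> (\<forall>j<dim_col A. uniform_vec (col A j))"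

definition almost_column_uniform :: "real mat \<Rightarrow> bool" where
  "almost_column_uniform A \<longleftrightarrow>
     dim_row A \<ge> 2 \<and> (\<exists>r<dim_row A. column_uniform (del_row A r))"

section \<open>Algorithms on real matrices\<close>

text \<open>
  The machine model is a real RAM with structured control. A program is a finite syntax tree that
  depends neither on the input nor on its size. A state has index registers holding natural numbers
  and two-dimensional arrays of exact reals, addressed through index registers.
  The only operations on reals are copying, addition, subtraction, floor, ceiling and comparison;
  there are no real constants and a real can influence an index register only through the outcome
  of a comparison.
\<close>

record state =
  reg :: "nat \<Rightarrow> nat"
  mem :: "nat \<times> nat \<times> nat \<Rightarrow> real"

datatype loc = Loc (arr: nat) (row_reg: nat) (col_reg: nat)

definition addr :: "state \<Rightarrow> loc \<Rightarrow> nat \<times> nat \<times> nat" where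
  "addr s l = (arr l, reg s (row_reg l), reg s (col_reg l))"

datatype instr =
    ISet nat nat
  | IAdd nat nat nat
  | ISub nat nat nat
  | RCopy loc loc
  | RAdd loc loc loc
  | RSub loc loc loc
  | RFloor loc loc
  | RCeil loc loc

definition set_reg :: "state \<Rightarrow> nat \<Rightarrow> nat \<Rightarrow> state" where
  "set_reg s p v = s\<lparr>reg := (reg s)(p := v)\<rparr>"

definition set_mem :: "state \<Rightarrow> loc \<Rightarrow> real \<Rightarrow> state" where
  "set_mem s l v = s\<lparr>mem := (mem s)(addr s l := v)\<rparr>"

definition val :: "state \<Rightarrow> loc \<Rightarrow> real" where
  "val s l = mem s (addr s l)"

text \<open>The first argument of an instruction is its target; \<open>ISub\<close> is truncated subtraction.\<close>

fun exec :: "instr \<Rightarrow> state \<Rightarrow> state" where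
  "exec (ISet p c) s = set_reg s p c"
| "exec (IAdd p q r) s = set_reg s p (reg s q + reg s r)"
| "exec (ISub p q r) s = set_reg s p (reg s q - reg s r)"
| "exec (RCopy l l1) s = set_mem s l (val s l1)"
| "exec (RAdd l l1 l2) s = set_mem s l (val s l1 + val s l2)"
| "exec (RSub l l1 l2) s = set_mem s l (val s l1 - val s l2)"
| "exec (RFloor l l1) s = set_mem s l (of_int \<lfloor>val s l1\<rfloor>)"
| "exec (RCeil l l1) s = set_mem s l (of_int \<lceil>val s l1\<rceil>)"

datatype cmp = ILess nat nat | IEq nat nat | RLess loc loc | REq loc loc

fun holds :: "cmp \<Rightarrow> state \<Rightarrow> bool" where
  "holds (ILess p q) s \<longleftrightarrow> reg s p < reg s q"
| "holds (IEq p q) s \<longleftrightarrow> reg s p = reg s q"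
| "holds (RLess l l') s \<longleftrightarrow> val s l < val s l'"
| "holds (REq l l') s \<longleftrightarrow> val s l = val s l'"

datatype program =
    Skip
  | Instr instr
  | Seq program program
  | Branch cmp program program
  | Loop cmp program

text \<open>
  \<open>run P s t s'\<close>: started in \<open>s\<close>, the program \<open>P\<close> halts in \<open>s'\<close> after \<open>t\<close> operations.
  Every executed instruction and every evaluated comparison is counted, so besides the elementary
  operations on reals \<open>t\<close> also includes copying and all work on index registers.
\<close>

inductive run :: "program \<Rightarrow> state \<Rightarrow> nat \<Rightarrow> state \<Rightarrow> bool" where
  run_Skip: "run Skip s 0 s"
| run_Instr: "run (Instr a) s 1 (exec a s)"
| run_Seq: "run P s t s' \<Longrightarrow> run Q s' t' s'' \<Longrightarrow> run (Seq P Q) s (t + t') s''"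
| run_Branch_True: "holds b s \<Longrightarrow> run P s t s' \<Longrightarrow> run (Branch b P Q) s (1 + t) s'"
| run_Branch_False: "\<not> holds b s \<Longrightarrow> run Q s t s' \<Longrightarrow> run (Branch b P Q) s (1 + t) s'"
| run_Loop_False: "\<not> holds b s \<Longrightarrow> run (Loop b P) s 1 s"
| run_Loop_True: "holds b s \<Longrightarrow> run P s t s' \<Longrightarrow> run (Loop b P) s' t' s'' \<Longrightarrow>
    run (Loop b P) s (1 + t + t') s''"

lemma run_deterministic:
  "run P s t s' \<Longrightarrow> run P s u s'' \<Longrightarrow> t = u \<and> s' = s''"
proof (induction arbitrary: u s'' rule: run.induct)
  case (run_Skip s)
  from run_Skip show ?case
    by cases simp
next
  case (run_Instr a s)
  from run_Instr show ?case
    by cases simp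
next
  case (run_Seq P s t s1 Q t' s2)
  from run_Seq.prems show ?case
    by cases ((metis run_Seq.IH)+)
next
  case (run_Branch_True b s P t s1 Q)
  from run_Branch_True.prems show ?case
    by cases ((metis run_Branch_True.IH run_Branch_True.hyps(1))+)
next
  case (run_Branch_False b s Q t s1 P)
  from run_Branch_False.prems show ?case
    by cases ((metis run_Branch_False.IH run_Branch_False.hyps(1))+)
next
  case (run_Loop_False b s P)
  from run_Loop_False.prems show ?case
    by cases (simp_all add: run_Loop_False.hyps)
next
  case (run_Loop_True b s P t s1 t' s2)
  from run_Loop_True.prems show ?case
    by cases ((metis run_Loop_True.IH run_Loop_True.hyps(1))+)
qed

text \<open>
  Input and output convention: registers 0 and 1 initially hold the numbers of rows and columns,
  array 0 holds the matrix, everything else is 0. On halting, a nonzero register 2 announces that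
  row 0 of array 1 holds a solution, and a zero register 2 announces that there is none.
\<close>

definition input_state :: "real mat \<Rightarrow> state" where
  "input_state A =
     \<lparr>reg = (\<lambda>p. if p = 0 then dim_row A else if p = 1 then dim_col A else 0),
      mem = (\<lambda>(a, i, j). if a = 0 \<and> i < dim_row A \<and> j < dim_col A then A $$ (i, j) else 0)\<rparr>"

definition announces_solution :: "state \<Rightarrow> bool" where
  "announces_solution s \<longleftrightarrow> reg s 2 \<noteq> 0"

definition output_vec :: "nat \<Rightarrow> state \<Rightarrow> real vec" where
  "output_vec n s = vec n (\<lambda>j. mem s (1, 0, j))"

end

theory Submission
  imports Defs
begin

text \<open>
  Let row \<open>r\<close> be the exceptional one and put \<open>b\<^sub>i\<^sub>j = a\<^sub>i\<^sub>j - a\<^sub>r\<^sub>j\<close>. An integer image exists if and only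
  if some column \<open>k\<close> satisfies \<open>b\<^sub>i\<^sub>k \<le> max\<^sub>j \<lfloor>b\<^sub>i\<^sub>j\<rfloor>\<close> for all \<open>i\<close>. Given a solution \<open>x\<close>, take for \<open>k\<close> a
  column that attains the maximum in row \<open>r\<close>; conversely, rounding every column except \<open>k\<close> down
  to integers makes the maximum in row \<open>i\<close> equal to \<open>max\<^sub>j \<lfloor>b\<^sub>i\<^sub>j\<rfloor>\<close>. The case \<open>j = k\<close> is allowed and
  takes care of the columns that are uniform already.
\<close>

section \<open>The criterion\<close>

text \<open>Equality of fractional parts is expressed by integer differences. Entries form a
  function on the original row numbers, so the same predicate serves matrices and memory contents
  without shifting indices past the removed row.\<close>

definition uniform_off :: "nat \<Rightarrow> nat \<Rightarrow> (nat \<Rightarrow> nat \<Rightarrow> real) \<Rightarrow> nat \<Rightarrow> bool" where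
  "uniform_off m n a r \<longleftrightarrow>
     (\<forall>i<m. \<forall>i'<m. i \<noteq> r \<longrightarrow> i' \<noteq> r \<longrightarrow> (\<forall>j<n. a i j - a i' j \<in> \<int>))"

text \<open>Row \<open>r\<close> may be included, for there both sides vanish at
  \<open>j = k\<close>; the program can thus test every row alike.\<close>

definition pivot_column :: "nat \<Rightarrow> nat \<Rightarrow> (nat \<Rightarrow> nat \<Rightarrow> real) \<Rightarrow> nat \<Rightarrow> nat \<Rightarrow> bool" where
  "pivot_column m n a r k \<longleftrightarrow> (\<forall>i<m. \<exists>j<n. a i k - a r k \<le> \<lfloor>a i j - a r j\<rfloor>)"

text \<open>The maxima of rows \<open>i\<close> and \<open>r\<close> differ by an integer
  \<open>z\<close>. Maximality in row \<open>i\<close> puts \<open>z\<close> above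
  \<open>a i k - a r k\<close>, maximality in row \<open>r\<close> puts it below
  \<open>a i j - a r j\<close>, and an integer below a real is below its floor.\<close>

lemma pivot_column_exists:
  assumes n: "n \<ge> 1" and r: "r < m"
    and int: "\<And>i. i < m \<Longrightarrow> Max ((\<lambda>j. a i j + x j) ` {..<n}) \<in> \<int>"
  shows "\<exists>k<n. pivot_column m n a r k"
proof -
  have ne: "(\<lambda>j. a i j + x j) ` {..<n} \<noteq> {}" for i
    using n by (auto simp: lessThan_empty_iff)
  have attained: "\<exists>j<n. Max ((\<lambda>j. a i j + x j) ` {..<n}) = a i j + x j" for i
    using Max_in[OF _ ne[of i]] by auto
  have upper: "a i j + x j \<le> Max ((\<lambda>j. a i j + x j) ` {..<n})" if "j < n" for i j
    using that by (intro Max_ge) auto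
  obtain k where k: "k < n" "Max ((\<lambda>j. a r j + x j) ` {..<n}) = a r k + x k"
    using attained by blast
  have "pivot_column m n a r k"
    unfolding pivot_column_def
  proof (intro allI impI)
    fix i assume i: "i < m"
    obtain j where j: "j < n" "Max ((\<lambda>j. a i j + x j) ` {..<n}) = a i j + x j"
      using attained by blast
    have "a i j + x j - (a r k + x k) \<in> \<int>"
      using int[OF i] int[OF r] j(2) k(2) by (metis Ints_diff)
    then obtain z where z: "a i j + x j - (a r k + x k) = of_int z"
      by (auto elim: Ints_cases)
    have "of_int z \<le> a i j - a r j"
      using z upper[OF j(1), of r] k(2) by linarith
    then have "z \<le> \<lfloor>a i j - a r j\<rfloor>"
      by (simp add: le_floor_iff)
    moreover have "a i k - a r k \<le> of_int z"
      using z upper[OF k(1), of i] j(2) by linarith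
    ultimately have "a i k - a r k \<le> of_int \<lfloor>a i j - a r j\<rfloor>"
      by linarith
    with j(1) show "\<exists>j<n. a i k - a r k \<le> \<lfloor>a i j - a r j\<rfloor>"
      by blast
  qed
  with k(1) show ?thesis by blast
qed

text \<open>Row \<open>q\<close> is a reference row: the rows other than \<open>r\<close> agree
  modulo 1, so a shift of column \<open>j\<close> that makes its entry in row \<open>q\<close> an
  integer does so in all of them. Column \<open>k\<close> is shifted to reach exactly 0 in row
  \<open>r\<close>. Both the explicit vector of the criterion and the output of the program are
  instances.\<close>

locale rounding =
  fixes m n :: nat and a :: "nat \<Rightarrow> nat \<Rightarrow> real" and x :: "nat \<Rightarrow> real" and r k q :: nat
  assumes r: "r < m" and k: "k < n" and q: "q < m" "q \<noteq> r"
    and unif: "uniform_off m n a r"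
    and pivot: "pivot_column m n a r k"
    and x_pivot: "x k = - a r k"
    and x_other: "\<And>j. j < n \<Longrightarrow> j \<noteq> k \<Longrightarrow> x j = of_int \<lfloor>a q j - a r j\<rfloor> - a q j"
begin

text \<open>The integer \<open>a i j - a q j\<close> can be moved out of the floor, which turns the
  rounding of row \<open>q\<close> into that of row \<open>i\<close>.\<close>

lemma entry_other:
  assumes "i < m" "i \<noteq> r" "j < n" "j \<noteq> k"
  shows "a i j + x j = of_int \<lfloor>a i j - a r j\<rfloor>"
proof -
  have "a i j - a q j \<in> \<int>"
    using unif assms q by (auto simp: uniform_off_def)
  then obtain z where z: "a i j - a q j = of_int z"
    by (auto elim: Ints_cases)
  then have "a i j - a r j = (a q j - a r j) + of_int z"
    by simp
  then have "\<lfloor>a i j - a r j\<rfloor> = \<lfloor>a q j - a r j\<rfloor> + z"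
    by (metis floor_add_int)
  with z x_other[OF assms(3,4)] show ?thesis by simp
qed

text \<open>Only column \<open>k\<close> contributes an unrounded difference, and the pivot
  condition keeps it below the largest floor.\<close>

lemma Max_row:
  assumes "i < m" "i \<noteq> r"
  shows "Max ((\<lambda>j. a i j + x j) ` {..<n}) = of_int (Max ((\<lambda>j. \<lfloor>a i j - a r j\<rfloor>) ` {..<n}))"
    (is "?L = of_int ?M")
proof (rule Max_eqI)
  show "finite ((\<lambda>j. a i j + x j) ` {..<n})" by simp
  have M: "\<lfloor>a i j - a r j\<rfloor> \<le> ?M" if "j < n" for j
    using that by (intro Max_ge) auto
  obtain j0 where j0: "j0 < n" "a i k - a r k \<le> \<lfloor>a i j0 - a r j0\<rfloor>"
    using pivot assms(1) by (auto simp: pivot_column_def)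
  have k_le: "a i k + x k \<le> of_int ?M"
    using j0 M[OF j0(1)] x_pivot by linarith
  show "y \<le> of_int ?M" if y: "y \<in> (\<lambda>j. a i j + x j) ` {..<n}" for y
  proof -
    obtain j where j: "j < n" "y = a i j + x j" using y by auto
    show ?thesis
      using entry_other[OF assms j(1)] M[OF j(1)] j(2) k_le by (cases "j = k") auto
  qed
  obtain j1 where j1: "j1 < n" "?M = \<lfloor>a i j1 - a r j1\<rfloor>"
    using Max_in[of "(\<lambda>j. \<lfloor>a i j - a r j\<rfloor>) ` {..<n}"] k by fastforce
  show "of_int ?M \<in> (\<lambda>j. a i j + x j) ` {..<n}"
  proof (cases "j1 = k")
    case False
    then show ?thesis using entry_other[OF assms j1(1)] j1 by force
  next
    \<comment> \<open>If column \<open>k\<close> has the largest floor, its difference lies between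
      that floor and the maximum of the floors, so it is itself an integer.\<close>
    case True
    have "real_of_int ?M \<le> a i k - a r k" unfolding j1(2) True by simp
    with k_le x_pivot have "of_int ?M = a i k + x k" by linarith
    with k show ?thesis by blast
  qed
qed

text \<open>In row \<open>r\<close> a rounded column contributes a floor minus its argument, which
  is at most 0, and column \<open>k\<close> contributes 0.\<close>

lemma Max_exceptional_row: "Max ((\<lambda>j. a r j + x j) ` {..<n}) = 0"
proof (rule Max_eqI)
  show "finite ((\<lambda>j. a r j + x j) ` {..<n})" by simp
  show "y \<le> 0" if y: "y \<in> (\<lambda>j. a r j + x j) ` {..<n}" for y
  proof -
    obtain j where j: "j < n" "y = a r j + x j" using y by auto
    have "x j \<le> - a r j"
    proof (cases "j = k")
      case False
      have "of_int \<lfloor>a q j - a r j\<rfloor> \<le> a q j - a r j" by simp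
      with x_other[OF j(1) False] show ?thesis by linarith
    qed (simp add: x_pivot)
    with j(2) show ?thesis by simp
  qed
  have "0 = a r k + x k" using x_pivot by simp
  with k show "0 \<in> (\<lambda>j. a r j + x j) ` {..<n}" by blast
qed

lemma Max_integer: "i < m \<Longrightarrow> Max ((\<lambda>j. a i j + x j) ` {..<n}) \<in> \<int>"
  using Max_row Max_exceptional_row by (cases "i = r") auto

end

section \<open>Translation to matrices with deleted rows and columns\<close>

lemma frac_eq_iff_diff_Ints: "frac (x::real) = frac y \<longleftrightarrow> x - y \<in> \<int>"
proof
  assume "frac x = frac y"
  then have "x - y = of_int (\<lfloor>x\<rfloor> - \<lfloor>y\<rfloor>)" by (simp add: frac_def)
  then show "x - y \<in> \<int>" by (metis Ints_of_int)
next
  assume "x - y \<in> \<int>"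
  then obtain z where "x = y + of_int z"
    by (metis Ints_cases add.commute diff_eq_eq)
  then show "frac x = frac y" by (simp add: frac_def)
qed

lemma column_uniform_del_row:
  assumes "A \<in> carrier_mat m n" "r < m" "column_uniform (del_row A r)"
  shows "uniform_off m n (\<lambda>i j. A $$ (i, j)) r"
proof -
  have *: "frac (A $$ (i, j)) = frac (A $$ (i', j))"
    if "i < m" "i' < m" "i \<noteq> r" "i' \<noteq> r" "j < n" for i i' j
  proof -
    \<comment> \<open>\<open>s\<close> inverts \<open>skip_index r\<close> on the rows other than
      \<open>r\<close>.\<close>
    define s where "s l = (if l < r then l else l - 1)" for l
    have s: "s l < m - 1 \<and> skip_index r (s l) = l" if "l < m" "l \<noteq> r" for l
      using that assms(2) by (auto simp: s_def skip_index_def)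
    have "frac (A $$ (skip_index r p, j)) = frac (A $$ (skip_index r p', j))"
      if "p < m - 1" "p' < m - 1" for p p'
    proof -
      have "uniform_vec (col (del_row A r) j)"
        using assms(1,3) \<open>j < n\<close> by (simp add: column_uniform_def del_row_def)
      moreover have "dim_vec (col (del_row A r) j) = m - 1"
        using assms(1) by (simp add: del_row_def)
      ultimately have "frac (col (del_row A r) j $ p) = frac (col (del_row A r) j $ p')"
        using that unfolding uniform_vec_def by metis
      then show ?thesis
        using that assms(1) \<open>j < n\<close> by (simp add: del_row_def)
    qed
    with s[of i] s[of i'] that show ?thesis by metis
  qed
  then show ?thesis
    by (auto simp: uniform_off_def frac_eq_iff_diff_Ints)
qed

lemma integer_vec_mp_mult:
  "A \<in> carrier_mat m n \<Longrightarrow> integer_vec (A \<otimes>\<^sub>m\<^sub>p x) \<longleftrightarrow>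
     (\<forall>i<m. Max ((\<lambda>j. A $$ (i, j) + x $ j) ` {..<n}) \<in> \<int>)"
  by (auto simp: integer_vec_def mp_mult_def)

lemma skip_index_image:
  assumes "k < n"
  shows "skip_index k ` {..<n - 1} = {..<n} - {k}"
proof (intro equalityI subsetI)
  fix l assume l: "l \<in> {..<n} - {k}"
  then have "l = skip_index k (if l < k then l else l - 1)"
    by (auto simp: skip_index_def)
  moreover have "(if l < k then l else l - 1) < n - 1"
    using l assms by auto
  ultimately show "l \<in> skip_index k ` {..<n - 1}" by blast
qed (use assms in \<open>auto simp: skip_index_def\<close>)

text \<open>Subtracting the fractional part \<open>f $ j\<close> from an entry leaves its floor, so
  each row maximum becomes a maximum of floors over the columns other than \<open>k\<close>.\<close>

lemma del_col_mp_mult: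
  assumes A: "A \<in> carrier_mat m n" and k: "k < n"
    and f: "f \<in> carrier_vec n" "\<And>i j. i < m - 1 \<Longrightarrow> j < n \<Longrightarrow> frac (A $$ (i, j)) = f $ j"
    and i: "i < m - 1"
  shows "(del_col (del_row A (m - 1)) k \<otimes>\<^sub>m\<^sub>p (- del_entry f k)) $ i =
    Max ((\<lambda>j. real_of_int \<lfloor>A $$ (i, j)\<rfloor>) ` ({..<n} - {k}))"
proof -
  have sk: "skip_index k j < n" if "j < n - 1" for j
    using that by (auto simp: skip_index_def)
  have "(\<lambda>j. del_col (del_row A (m - 1)) k $$ (i, j) + (- del_entry f k) $ j) ` {..<n - 1} =
      (\<lambda>j. real_of_int \<lfloor>A $$ (i, skip_index k j)\<rfloor>) ` {..<n - 1}"
  proof (rule image_cong[OF refl])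
    fix j assume j: "j \<in> {..<n - 1}"
    have "skip_index (m - 1) i = i" using i by (simp add: skip_index_def)
    then show "del_col (del_row A (m - 1)) k $$ (i, j) + (- del_entry f k) $ j =
        real_of_int \<lfloor>A $$ (i, skip_index k j)\<rfloor>"
      using A f(1) f(2)[OF i sk, of j, symmetric] i j sk[of j]
      by (simp add: del_col_def del_row_def del_entry_def frac_def)
  qed
  also have "\<dots> = (\<lambda>j. real_of_int \<lfloor>A $$ (i, j)\<rfloor>) ` ({..<n} - {k})"
    unfolding skip_index_image[OF k, symmetric] by (simp add: image_image)
  finally show ?thesis
    using A i by (simp add: mp_mult_def del_col_def del_row_def)
qed

text \<open>Since the last row is 0, the differences to it are the entries themselves, and the
  inequality for \<open>k\<close> is the pivot condition with \<open>j = k\<close> excluded.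
  Excluding it loses nothing: in a column that is not uniform no entry above the last row is an
  integer.\<close>

theorem last_row_zero_criterion:
  fixes m n :: nat and A :: "real mat" and f :: "real vec"
  defines "Abar \<equiv> del_row A (m - 1)"
  assumes m: "m \<ge> 2" and n: "n \<ge> 2" and A: "A \<in> carrier_mat m n"
    and cu: "column_uniform Abar"
    and non_unif: "\<And>j. j < n \<Longrightarrow> \<not> uniform_vec (col A j)"
    and zero: "\<And>j. j < n \<Longrightarrow> A $$ (m - 1, j) = 0"
    and f: "f \<in> carrier_vec n" "\<And>i j. i < m - 1 \<Longrightarrow> j < n \<Longrightarrow> frac (A $$ (i, j)) = f $ j"
  shows "(\<exists>x\<in>carrier_vec n. integer_vec (A \<otimes>\<^sub>m\<^sub>p x)) \<longleftrightarrow>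
      (\<exists>k<n. del_col Abar k \<otimes>\<^sub>m\<^sub>p (- del_entry f k) \<ge> col Abar k)" (is ?equiv)
    and "\<And>k x. k < n \<Longrightarrow> del_col Abar k \<otimes>\<^sub>m\<^sub>p (- del_entry f k) \<ge> col Abar k \<Longrightarrow>
      x = - vec n (\<lambda>j. if j = k then 0 else f $ j) \<Longrightarrow>
      integer_vec (A \<otimes>\<^sub>m\<^sub>p x) \<and>
      A \<otimes>\<^sub>m\<^sub>p x = (del_col Abar k \<otimes>\<^sub>m\<^sub>p (- del_entry f k)) @\<^sub>v vec 1 (\<lambda>_. 0)"
      (is "\<And>k x. _ \<Longrightarrow> ?ineq k \<Longrightarrow> _ \<Longrightarrow> ?sol k x")
proof -
  let ?a = "\<lambda>i j. A $$ (i, j)"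
  have unif: "uniform_off m n ?a (m - 1)"
    using column_uniform_del_row[OF A] cu m by (simp add: Abar_def)
  have rows: "skip_index (m - 1) i = i" if "i < m - 1" for i
    using that by (simp add: skip_index_def)
  \<comment> \<open>One integer entry forces \<open>f $ j = 0\<close>, and together with the 0 in
    the last row the whole column would be uniform.\<close>
  have not_Ints: "?a i j \<notin> \<int>" if ij: "i < m - 1" "j < n" for i j
  proof
    assume "?a i j \<in> \<int>"
    then have f0: "f $ j = 0" using f(2)[OF ij] by (metis frac_eq_0_iff)
    have frac0: "frac (?a l j) = 0" if "l < m" for l
    proof (cases "l = m - 1")
      case True
      then show ?thesis using zero[OF ij(2)] by simp
    next
      case False
      then show ?thesis using f(2)[of l j] f0 ij(2) that by simp
    qed
    have "uniform_vec (col A j)"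
      using A ij(2) frac0 by (auto simp: uniform_vec_def simp del: frac_eq_0_iff)
    with non_unif[OF ij(2)] show False by simp
  qed
  have ineq_iff: "?ineq k \<longleftrightarrow> (\<forall>i<m - 1. \<exists>j<n. j \<noteq> k \<and> ?a i k \<le> \<lfloor>?a i j\<rfloor>)"
    if k: "k < n" for k
  proof -
    \<comment> \<open>Because \<open>n \<ge> 2\<close> a second column remains, so the maximum is
      over a nonempty set.\<close>
    have ne: "{..<n} - {k} \<noteq> {}"
    proof -
      have "(if k = 0 then 1 else 0) \<in> {..<n} - {k}" using n by auto
      then show ?thesis by blast
    qed
    have "?ineq k \<longleftrightarrow> (\<forall>i<m - 1. ?a i k \<le> Max ((\<lambda>j. real_of_int \<lfloor>?a i j\<rfloor>) ` ({..<n} - {k})))"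
    proof -
      have "?ineq k \<longleftrightarrow> (\<forall>i<m - 1. col Abar k $ i \<le>
          (del_col Abar k \<otimes>\<^sub>m\<^sub>p (- del_entry f k)) $ i)"
        using A k by (auto simp: less_eq_vec_def mp_mult_def del_col_def del_row_def Abar_def)
      moreover have "col Abar k $ i = ?a i k" if "i < m - 1" for i
        using A k that rows[OF that] by (simp add: Abar_def del_row_def)
      moreover have "(del_col Abar k \<otimes>\<^sub>m\<^sub>p (- del_entry f k)) $ i =
          Max ((\<lambda>j. real_of_int \<lfloor>?a i j\<rfloor>) ` ({..<n} - {k}))" if "i < m - 1" for i
        unfolding Abar_def by (rule del_col_mp_mult[OF A k f that])
      ultimately show ?thesis by simp
    qed
    also have "\<dots> \<longleftrightarrow> (\<forall>i<m - 1. \<exists>j<n. j \<noteq> k \<and> ?a i k \<le> \<lfloor>?a i j\<rfloor>)"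
    proof -
      have "y \<le> Max (g ` ({..<n} - {k})) \<longleftrightarrow> (\<exists>j<n. j \<noteq> k \<and> y \<le> g j)"
        for y :: real and g
        using ne by (subst Max_ge_iff) (simp_all, blast)
      then show ?thesis by simp
    qed
    finally show ?thesis .
  qed
  show sol: "?sol k x" if k: "k < n" and ineq: "?ineq k"
    and x: "x = - vec n (\<lambda>j. if j = k then 0 else f $ j)" for k x
  proof -
    have pivot: "pivot_column m n ?a (m - 1) k"
      unfolding pivot_column_def
    proof (intro allI impI)
      fix i assume "i < m"
      then consider "i = m - 1" | "i < m - 1" by linarith
      then show "\<exists>j<n. ?a i k - ?a (m - 1) k \<le> \<lfloor>?a i j - ?a (m - 1) j\<rfloor>"
      proof cases
        case 1
        then show ?thesis using k by (intro exI[of _ k]) simp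
      next
        case 2
        then obtain j where "j < n" "?a i k \<le> \<lfloor>?a i j\<rfloor>"
          using ineq ineq_iff[OF k] by blast
        then show ?thesis using zero k by (intro exI[of _ j]) simp
      qed
    qed
    \<comment> \<open>Row 0 is the reference row: there \<open>- f $ j\<close> is the floor of the
      entry minus the entry.\<close>
    have x_other: "x $ j = of_int \<lfloor>?a 0 j - ?a (m - 1) j\<rfloor> - ?a 0 j" if j: "j < n" "j \<noteq> k" for j
    proof -
      have "f $ j = ?a 0 j - of_int \<lfloor>?a 0 j\<rfloor>"
        using f(2)[of 0 j] j(1) m by (simp add: frac_def)
      then show ?thesis using j zero[OF j(1)] by (simp add: x)
    qed
    have x_pivot: "x $ k = - ?a (m - 1) k"
      using zero[OF k] k by (simp add: x)
    have bounds: "m - 1 < m" "0 < m" "0 \<noteq> m - 1"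
      using m by auto
    interpret rounding m n ?a "\<lambda>j. x $ j" "m - 1" k 0
      by (rule rounding.intro; (fact bounds k unif pivot x_pivot)?) (rule x_other)
    have int: "integer_vec (A \<otimes>\<^sub>m\<^sub>p x)"
      using Max_integer integer_vec_mp_mult[OF A] by blast
    have "A \<otimes>\<^sub>m\<^sub>p x = (del_col Abar k \<otimes>\<^sub>m\<^sub>p (- del_entry f k)) @\<^sub>v vec 1 (\<lambda>_. 0)"
    proof (rule eq_vecI)
      have d: "dim_vec (del_col Abar k \<otimes>\<^sub>m\<^sub>p (- del_entry f k)) = m - 1"
        using A by (simp add: mp_mult_def del_col_def del_row_def Abar_def)
      show "dim_vec (A \<otimes>\<^sub>m\<^sub>p x) =
          dim_vec ((del_col Abar k \<otimes>\<^sub>m\<^sub>p (- del_entry f k)) @\<^sub>v vec 1 (\<lambda>_. 0))"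
        using A m d by (simp add: mp_mult_def)
      fix i assume "i < dim_vec ((del_col Abar k \<otimes>\<^sub>m\<^sub>p (- del_entry f k)) @\<^sub>v vec 1 (\<lambda>_. 0))"
      then have i: "i < m" using d m by simp
      have Ax: "(A \<otimes>\<^sub>m\<^sub>p x) $ i = Max ((\<lambda>j. ?a i j + x $ j) ` {..<n})"
        using A i by (simp add: mp_mult_def)
      show "(A \<otimes>\<^sub>m\<^sub>p x) $ i =
          ((del_col Abar k \<otimes>\<^sub>m\<^sub>p (- del_entry f k)) @\<^sub>v vec 1 (\<lambda>_. 0)) $ i"
      proof (cases "i = m - 1")
        case True
        then show ?thesis using Ax Max_exceptional_row d m by simp
      next
        case False
        then have i': "i < m - 1" using i by simp
        obtain j0 where j0: "j0 < n" "j0 \<noteq> k" "?a i k \<le> \<lfloor>?a i j0\<rfloor>"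
          using ineq ineq_iff[OF k] i' by blast
        \<comment> \<open>Column \<open>k\<close> contributes \<open>?a i k\<close>, which is
          dominated by the floor in column \<open>j0\<close>, so dropping it keeps the
          maximum.\<close>
        have "Max ((\<lambda>j. ?a i j + x $ j) ` {..<n}) = Max ((\<lambda>j. real_of_int \<lfloor>?a i j\<rfloor>) ` ({..<n} - {k}))"
        proof -
          have "(\<lambda>j. ?a i j + x $ j) ` {..<n} =
              insert (?a i k) ((\<lambda>j. real_of_int \<lfloor>?a i j\<rfloor>) ` ({..<n} - {k}))"
          proof -
            have "(\<lambda>j. ?a i j + x $ j) ` {..<n} = (\<lambda>j. ?a i j + x $ j) ` insert k ({..<n} - {k})"
              using k by (simp add: insert_absorb)
            also have "\<dots> = insert (?a i k + x $ k) ((\<lambda>j. ?a i j + x $ j) ` ({..<n} - {k}))"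
              by (rule image_insert)
            also have "(\<lambda>j. ?a i j + x $ j) ` ({..<n} - {k}) =
                (\<lambda>j. real_of_int \<lfloor>?a i j\<rfloor>) ` ({..<n} - {k})"
              using entry_other[OF i False] zero by (intro image_cong) auto
            also have "?a i k + x $ k = ?a i k" using k by (simp add: x)
            finally show ?thesis .
          qed
          moreover have "?a i k \<le> Max ((\<lambda>j. real_of_int \<lfloor>?a i j\<rfloor>) ` ({..<n} - {k}))"
            using j0 by (subst Max_ge_iff) auto
          moreover have "(\<lambda>j. real_of_int \<lfloor>?a i j\<rfloor>) ` ({..<n} - {k}) \<noteq> {}"
            using j0 by auto
          ultimately show ?thesis by (simp add: max_def)
        qed
        then show ?thesis
          using Ax d i' del_col_mp_mult[OF A k f i'] by (simp add: Abar_def)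
      qed
    qed
    with int show ?thesis by blast
  qed
  show ?equiv
  proof
    assume "\<exists>x\<in>carrier_vec n. integer_vec (A \<otimes>\<^sub>m\<^sub>p x)"
    then obtain x where "integer_vec (A \<otimes>\<^sub>m\<^sub>p x)" by blast
    then obtain k where k: "k < n" "pivot_column m n ?a (m - 1) k"
      using pivot_column_exists[of n "m - 1" m ?a "\<lambda>j. x $ j"] m n integer_vec_mp_mult[OF A]
      by auto
    have "\<exists>j<n. j \<noteq> k \<and> ?a i k \<le> \<lfloor>?a i j\<rfloor>" if i: "i < m - 1" for i
    proof -
      obtain j where j: "j < n" "?a i k - ?a (m - 1) k \<le> \<lfloor>?a i j - ?a (m - 1) j\<rfloor>"
        using k(2) less_le_trans[OF i diff_le_self] unfolding pivot_column_def by blast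
      then have le: "?a i k \<le> \<lfloor>?a i j\<rfloor>" using zero k(1) by simp
      \<comment> \<open>A number bounded by its own floor is an integer, contrary to
        \<open>not_Ints\<close>.\<close>
      have "j \<noteq> k"
      proof
        assume "j = k"
        with le have "?a i k = of_int \<lfloor>?a i k\<rfloor>" by (metis of_int_floor_le order.antisym)
        with not_Ints[OF i k(1)] show False by (metis Ints_of_int)
      qed
      with j(1) le show ?thesis by blast
    qed
    with ineq_iff k(1) show "\<exists>k<n. ?ineq k" by blast
  next
    assume "\<exists>k<n. ?ineq k"
    then obtain k where "k < n" "?ineq k" by blast
    from sol[OF this refl] show "\<exists>x\<in>carrier_vec n. integer_vec (A \<otimes>\<^sub>m\<^sub>p x)"
      by (intro bexI[of _ "- vec n (\<lambda>j. if j = k then 0 else f $ j)"]) auto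
  qed
qed

section \<open>Verifying programs\<close>

text \<open>Total correctness with a cost: the existential quantifier asserts termination, and by
  determinism the run is the only one.\<close>

definition wp :: "program \<Rightarrow> state \<Rightarrow> (nat \<Rightarrow> state \<Rightarrow> bool) \<Rightarrow> bool" where
  "wp P s Q \<longleftrightarrow> (\<exists>t s'. run P s t s' \<and> Q t s')"

inductive_cases run_Skip_E: "run Skip s t s'"
inductive_cases run_Instr_E: "run (Instr a) s t s'"
inductive_cases run_Seq_E: "run (Seq P R) s t s'"
inductive_cases run_Branch_E: "run (Branch b P R) s t s'"

lemma wp_Skip: "wp Skip s Q \<longleftrightarrow> Q 0 s"
  unfolding wp_def by (blast intro: run_Skip elim: run_Skip_E)

lemma wp_Instr: "wp (Instr a) s Q \<longleftrightarrow> Q 1 (exec a s)"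
  unfolding wp_def by (auto elim!: run_Instr_E) (blast intro: run_Instr[simplified])

lemma wp_Seq: "wp (Seq P R) s Q \<longleftrightarrow> wp P s (\<lambda>t s'. wp R s' (\<lambda>u. Q (t + u)))"
  unfolding wp_def by (blast intro: run_Seq elim: run_Seq_E)

lemma wp_Branch: "wp (Branch b P R) s Q \<longleftrightarrow>
    (if holds b s then wp P s (\<lambda>t. Q (1 + t)) else wp R s (\<lambda>t. Q (1 + t)))"
proof -
  have "wp (Branch b P R) s Q \<longleftrightarrow> wp P s (\<lambda>t. Q (1 + t))" if "holds b s"
    unfolding wp_def using that
    by (auto elim!: run_Branch_E) (blast intro: run_Branch_True[simplified])
  moreover have "wp (Branch b P R) s Q \<longleftrightarrow> wp R s (\<lambda>t. Q (1 + t))" if "\<not> holds b s"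
    unfolding wp_def using that
    by (auto elim!: run_Branch_E) (blast intro: run_Branch_False[simplified])
  ultimately show ?thesis by simp
qed

lemmas wp_rules = wp_Skip wp_Instr wp_Seq wp_Branch

lemma wp_mono: "wp P s Q \<Longrightarrow> (\<And>t s'. Q t s' \<Longrightarrow> Q' t s') \<Longrightarrow> wp P s Q'"
  unfolding wp_def by blast

text \<open>Registers 0 to 2 are fixed by the input and output convention. \<open>zero_reg\<close>
  keeps its initial 0; it addresses row 0, stands for a false flag, and turns \<open>IAdd\<close>
  into a copy.\<close>

abbreviation (input) "rows_reg \<equiv> 0 :: nat"
abbreviation (input) "cols_reg \<equiv> 1 :: nat"
abbreviation (input) "res_reg \<equiv> 2 :: nat"
abbreviation (input) "i_reg \<equiv> 3 :: nat"
abbreviation (input) "j_reg \<equiv> 4 :: nat"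
abbreviation (input) "r_reg \<equiv> 5 :: nat"
abbreviation (input) "k_reg \<equiv> 6 :: nat"
abbreviation (input) "one_reg \<equiv> 7 :: nat"
abbreviation (input) "zero_reg \<equiv> 8 :: nat"
abbreviation (input) "seen_reg \<equiv> 9 :: nat"
abbreviation (input) "found_reg \<equiv> 10 :: nat"
abbreviation (input) "all_reg \<equiv> 11 :: nat"
abbreviation (input) "pivot_reg \<equiv> 12 :: nat"
abbreviation (input) "q_reg \<equiv> 13 :: nat"

abbreviation (input) "entry \<equiv> Loc 0"
abbreviation (input) "output_cell \<equiv> Loc 1 zero_reg j_reg"
abbreviation (input) "tmp1 \<equiv> Loc 2 zero_reg zero_reg"
abbreviation (input) "tmp2 \<equiv> Loc 3 zero_reg zero_reg"

definition for_upto :: "nat \<Rightarrow> nat \<Rightarrow> program \<Rightarrow> program" where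
  "for_upto p q body =
     Seq (Instr (ISet p 0)) (Loop (ILess p q) (Seq body (Instr (IAdd p p one_reg))))"

text \<open>A round costs at most \<open>T\<close> for the body plus 2 for the comparison and the
  increment; the leading 2 pays for setting the counter and for the last, failing comparison. As the
  invariant ties the counter to \<open>c\<close>, the step obligation forces \<open>one_reg\<close>
  to hold 1.\<close>

lemma wp_for_upto:
  assumes inv: "\<And>c s. I c s \<Longrightarrow> reg s p = c \<and> reg s q = N"
    and init: "I 0 (set_reg s p 0)"
    and step: "\<And>c s. c < N \<Longrightarrow> I c s \<Longrightarrow>
      wp body s (\<lambda>t s'. t \<le> T \<and> I (Suc c) (set_reg s' p (reg s' p + reg s' one_reg)))"
    and post: "\<And>t s'. t \<le> 2 + N * (T + 2) \<Longrightarrow> I N s' \<Longrightarrow> Q t s'"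
  shows "wp (for_upto p q body) s Q"
proof -
  let ?L = "Loop (ILess p q) (Seq body (Instr (IAdd p p one_reg)))"
  have loop: "\<exists>t s'. run ?L s t s' \<and> t \<le> 1 + (N - c) * (T + 2) \<and> I N s'"
    if "I c s" "c \<le> N" for c s
    using that
  proof (induction "N - c" arbitrary: c s)
    case 0
    then have "\<not> holds (ILess p q) s" and c: "c = N"
      using inv[OF 0(2)] by auto
    from run_Loop_False[OF this(1)] have "run ?L s 1 s" .
    moreover have "1 \<le> 1 + (N - c) * (T + 2)" by simp
    ultimately show ?case using 0(2) c by blast
  next
    case (Suc d)
    then have c: "c < N" and d: "d = N - Suc c" by simp_all
    have h: "holds (ILess p q) s" using inv[OF Suc(3)] c by simp
    obtain t s' where t: "run body s t s'" "t \<le> T"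
        "I (Suc c) (exec (IAdd p p one_reg) s')"
      using step[OF c Suc(3)] by (auto simp: wp_def)
    obtain u s'' where u: "run ?L (exec (IAdd p p one_reg) s') u s''"
        "u \<le> 1 + (N - Suc c) * (T + 2)" "I N s''"
      using Suc(1)[OF d t(3)] c by auto
    have "run ?L s (1 + (t + 1) + u) s''"
      using run_Loop_True[OF h run_Seq[OF t(1) run_Instr] u(1)] .
    moreover have "1 + (t + 1) + u \<le> 1 + (N - c) * (T + 2)"
    proof -
      have "N - c = Suc (N - Suc c)" using c by simp
      then show ?thesis using t(2) u(2) by simp
    qed
    ultimately show ?case using u(3) by blast
  qed
  obtain t s' where t: "run ?L (set_reg s p 0) t s'" "t \<le> 1 + N * (T + 2)" "I N s'"
    using loop[OF init] by auto
  have "run (for_upto p q body) s (1 + t) s'"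
    unfolding for_upto_def
    by (rule run_Seq[OF run_Instr]) (use t in simp)
  moreover have "Q (1 + t) s'"
    using t by (intro post) auto
  ultimately show ?thesis by (auto simp: wp_def)
qed

text \<open>A frame condition on index registers only; preservation of the input array is part of
  \<open>ready\<close>.\<close>

definition agree_off :: "nat set \<Rightarrow> state \<Rightarrow> state \<Rightarrow> bool" where
  "agree_off X s s' \<longleftrightarrow> (\<forall>p. p \<notin> X \<longrightarrow> reg s' p = reg s p)"

lemmas exec_simps = val_def addr_def set_reg_def set_mem_def

section \<open>The program\<close>

text \<open>A difference is an integer exactly if it equals its floor. The first deviating row is
  stored in \<open>r_reg\<close>; a second one resets the register to 0.\<close>

definition find_row :: program where
  "find_row = for_upto i_reg rows_reg (for_upto j_reg cols_reg (
     Seq (Instr (RSub tmp1 (entry i_reg j_reg) (entry zero_reg j_reg)))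
    (Seq (Instr (RFloor tmp2 tmp1))
         (Branch (REq tmp1 tmp2) Skip
         (Branch (IEq seen_reg zero_reg)
           (Seq (Instr (ISet seen_reg 1)) (Instr (IAdd r_reg i_reg zero_reg)))
           (Branch (IEq r_reg i_reg) Skip (Instr (ISet r_reg 0))))))))"

definition search_row :: program where
  "search_row = for_upto j_reg cols_reg (
     Seq (Instr (RSub tmp1 (entry i_reg j_reg) (entry r_reg j_reg)))
    (Seq (Instr (RFloor tmp1 tmp1))
    (Seq (Instr (RSub tmp2 (entry i_reg k_reg) (entry r_reg k_reg)))
         (Branch (RLess tmp1 tmp2) Skip (Instr (ISet found_reg 1))))))"

definition test_column :: program where
  "test_column = for_upto i_reg rows_reg (
     Seq (Instr (ISet found_reg 0))
    (Seq search_row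
         (Branch (IEq found_reg zero_reg) (Instr (ISet all_reg 0)) Skip)))"

text \<open>The nesting over \<open>k\<close>, \<open>i\<close> and \<open>j\<close> produces the
  order \<open>m * n\<^sup>2\<close>. A later pivot column overwrites an earlier one, and any of
  them serves.\<close>

definition find_pivot :: program where
  "find_pivot = for_upto k_reg cols_reg (
     Seq (Instr (ISet all_reg 1))
    (Seq test_column
         (Branch (IEq all_reg zero_reg) Skip
           (Seq (Instr (ISet res_reg 1)) (Instr (IAdd pivot_reg k_reg zero_reg))))))"

text \<open>With \<open>q = r\<close> for the pivot column, \<open>\<lfloor>a\<^sub>q\<^sub>j - a\<^sub>r\<^sub>j\<rfloor> - a\<^sub>q\<^sub>j\<close> is \<open>- a\<^sub>r\<^sub>j\<close>, so one formula serves all columns.\<close>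

definition write_output :: program where
  "write_output = for_upto j_reg cols_reg (
     Seq (Branch (IEq j_reg pivot_reg) (Instr (IAdd q_reg r_reg zero_reg))
           (Branch (IEq r_reg zero_reg) (Instr (ISet q_reg 1)) (Instr (ISet q_reg 0))))
    (Seq (Instr (RSub tmp1 (entry q_reg j_reg) (entry r_reg j_reg)))
    (Seq (Instr (RFloor tmp1 tmp1))
         (Instr (RSub output_cell tmp1 (entry q_reg j_reg))))))"

text \<open>The output is written even without a pivot column; \<open>res_reg\<close> is then still
  0, so nothing is announced.\<close>

definition solver :: program where
  "solver = Seq (Instr (ISet one_reg 1)) (Seq find_row (Seq find_pivot write_output))"

text \<open>
  The scan for the exceptional row compares all rows with row 0 modulo 1; \<open>D\<close> is the set of rows
  seen to differ. If there are two of them, then row 0 is the exceptional one.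
\<close>

definition scan_inv :: "nat set \<Rightarrow> nat \<Rightarrow> nat \<Rightarrow> bool" where
  "scan_inv D seen r \<longleftrightarrow>
     seen = 0 \<and> r = 0 \<and> D = {} \<or>
     seen = 1 \<and> r \<noteq> 0 \<and> D = {r} \<or>
     seen = 1 \<and> r = 0 \<and> (\<exists>d\<in>D. \<exists>e\<in>D. d \<noteq> e)"

text \<open>The cases are the three branches \<open>find_row\<close> can take at a deviating entry
  of row \<open>i\<close>.\<close>

lemma scan_inv_insert:
  assumes "scan_inv D seen r" "i \<noteq> 0"
  shows "seen = 0 \<Longrightarrow> scan_inv (insert i D) 1 i"
    and "seen \<noteq> 0 \<Longrightarrow> r = i \<Longrightarrow> scan_inv (insert i D) seen r"
    and "seen \<noteq> 0 \<Longrightarrow> r \<noteq> i \<Longrightarrow> scan_inv (insert i D) seen 0"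
  using assms by (auto simp: scan_inv_def)

text \<open>If at most one row deviates from row 0, removing it (or row 0 if there is none) leaves
  congruent rows. If two deviate, then \<open>r0\<close> must be 0: otherwise every row except
  \<open>r0\<close> would agree with row 0.\<close>

lemma scan_inv_uniform_off:
  assumes scan: "scan_inv {i. i < m \<and> (\<exists>j<n. a i j - a 0 j \<notin> \<int>)} seen r"
    and r0: "uniform_off m n a r0" and m: "m \<ge> 1"
  shows "r < m \<and> uniform_off m n a r"
proof -
  have cong0: "uniform_off m n a r"
    if "\<And>i j. i < m \<Longrightarrow> i \<noteq> r \<Longrightarrow> j < n \<Longrightarrow> a i j - a 0 j \<in> \<int>"
    unfolding uniform_off_def
  proof (intro allI impI)
    fix i i' j assume "i < m" "i' < m" "i \<noteq> r" "i' \<noteq> r" "j < n"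
    then have "a i j - a 0 j \<in> \<int>" "a i' j - a 0 j \<in> \<int>"
      using that by blast+
    from Ints_diff[OF this] show "a i j - a i' j \<in> \<int>" by simp
  qed
  from scan consider
      "r = 0" "\<And>i j. i < m \<Longrightarrow> j < n \<Longrightarrow> a i j - a 0 j \<in> \<int>"
    | "{i. i < m \<and> (\<exists>j<n. a i j - a 0 j \<notin> \<int>)} = {r}"
    | d e where "r = 0" "d < m" "e < m" "d \<noteq> e"
        "\<exists>j<n. a d j - a 0 j \<notin> \<int>" "\<exists>j<n. a e j - a 0 j \<notin> \<int>"
    unfolding scan_inv_def by blast
  then show ?thesis
  proof cases
    case 1
    then show ?thesis using cong0 m by auto
  next
    case 2
    then show ?thesis using cong0 by blast
  next
    case 3
    have "r0 = 0"
    proof (rule ccontr)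
      assume "r0 \<noteq> 0"
      then have "\<forall>j<n. a l j - a 0 j \<in> \<int>" if "l < m" "l \<noteq> r0" for l
        using r0[unfolded uniform_off_def, rule_format, of l 0] that m by auto
      then have "d = r0" "e = r0" using 3 by blast+
      with 3(4) show False by simp
    qed
    with 3 r0 m show ?thesis by simp
  qed
qed

lemma eq_floor_iff: "x = of_int \<lfloor>x\<rfloor> \<longleftrightarrow> (x::real) \<in> \<int>"
  by (simp only: frac_eq_0_iff[symmetric] frac_def right_minus_eq)

section \<open>Specifications and costs of the phases of the solver\<close>

locale solver_run =
  fixes m n :: nat and a :: "nat \<Rightarrow> nat \<Rightarrow> real"
begin

text \<open>\<open>a\<close> describes array 0 at all indices, so that reads create no range
  conditions.\<close>

definition ready :: "state \<Rightarrow> bool" where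
  "ready s \<longleftrightarrow> reg s rows_reg = m \<and> reg s cols_reg = n \<and> reg s one_reg = 1 \<and> reg s zero_reg = 0
     \<and> (\<forall>i j. mem s (0, i, j) = a i j)"

lemma wp_find_row:
  assumes "ready s" "reg s seen_reg = 0" "reg s r_reg = 0"
  shows "wp find_row s (\<lambda>t s'. t \<le> 2 + m * (2 + n * 8 + 2) \<and> ready s' \<and>
    reg s' res_reg = reg s res_reg \<and>
    scan_inv {i. i < m \<and> (\<exists>j<n. a i j - a 0 j \<notin> \<int>)} (reg s' seen_reg) (reg s' r_reg))"
proof -
  \<comment> \<open>\<open>D i j\<close> is the set of deviating rows known just before entry
    \<open>(i, j)\<close> is inspected: the finished rows, and row \<open>i\<close> if one of its
    first \<open>j\<close> entries deviates. A finished row passes into the next start,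
    \<open>D i n = D (Suc i) 0\<close>.\<close>
  define D where "D i j = {l. l < i \<and> (\<exists>j<n. a l j - a 0 j \<notin> \<int>)} \<union>
    {l. l = i \<and> (\<exists>j'<j. a l j' - a 0 j' \<notin> \<int>)}" for i j
  define I where "I i j s' \<longleftrightarrow> ready s' \<and> reg s' res_reg = reg s res_reg \<and> reg s' i_reg = i \<and>
    scan_inv (D i j) (reg s' seen_reg) (reg s' r_reg)" for i j s'
  have D0: "D 0 0 = {}" by (simp add: D_def)
  have D_row: "D i n = D (Suc i) 0" for i
    by (auto simp: D_def less_Suc_eq)
  have D_same: "D i (Suc j) = D i j" if "a i j - a 0 j \<in> \<int>" for i j
    using that by (auto simp: D_def less_Suc_eq)
  have D_insert: "D i (Suc j) = insert i (D i j)" if "a i j - a 0 j \<notin> \<int>" for i j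
    using that by (auto simp: D_def less_Suc_eq)
  show ?thesis
    unfolding find_row_def
  proof (rule wp_for_upto[where N = m and T = "2 + n * 8" and I = "\<lambda>i. I i 0"])
    show "I 0 0 (set_reg s i_reg 0)"
      using assms D0 by (simp add: I_def ready_def scan_inv_def set_reg_def)
    show "reg s' i_reg = i \<and> reg s' rows_reg = m" if "I i 0 s'" for i s'
      using that by (simp add: I_def ready_def)
    show "t \<le> 2 + m * (2 + n * 8 + 2) \<and> ready s' \<and> reg s' res_reg = reg s res_reg \<and>
        scan_inv {i. i < m \<and> (\<exists>j<n. a i j - a 0 j \<notin> \<int>)} (reg s' seen_reg) (reg s' r_reg)"
      if "t \<le> 2 + m * (2 + n * 8 + 2)" "I m 0 s'" for t s'
      using that by (simp add: I_def D_def)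
    fix i s1 assume s1: "I i 0 s1"
    show "wp (for_upto j_reg cols_reg (
         Seq (Instr (RSub tmp1 (entry i_reg j_reg) (entry zero_reg j_reg)))
        (Seq (Instr (RFloor tmp2 tmp1))
             (Branch (REq tmp1 tmp2) Skip
             (Branch (IEq seen_reg zero_reg)
               (Seq (Instr (ISet seen_reg 1)) (Instr (IAdd r_reg i_reg zero_reg)))
               (Branch (IEq r_reg i_reg) Skip (Instr (ISet r_reg 0))))))))
        s1 (\<lambda>t s'. t \<le> 2 + n * 8 \<and>
          I (Suc i) 0 (set_reg s' i_reg (reg s' i_reg + reg s' one_reg)))"
    \<comment> \<open>The longest paths take six operations: two on reals, then four comparisons and
      assignments.\<close>
    proof (rule wp_for_upto[where N = n and T = 6 and I = "\<lambda>j s'. I i j s' \<and> reg s' j_reg = j"],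
        goal_cases)
      case (1 j s')
      then show ?case by (simp add: I_def ready_def)
    next
      case 2
      then show ?case using s1 by (simp add: I_def ready_def set_reg_def)
    next
      case (3 j s2)
      show ?case
      proof (cases "a i j - a 0 j \<in> \<int>")
        case True
        then show ?thesis
          using 3 by (simp add: wp_rules exec_simps I_def ready_def eq_floor_iff D_same)
      next
        case False
        \<comment> \<open>Row 0 differs from itself by 0, an integer.\<close>
        then have "i \<noteq> 0" by (metis Ints_0 diff_self)
        with 3 False show ?thesis
          using scan_inv_insert[of "D i j" "reg s2 seen_reg" "reg s2 r_reg" i]
          by (auto simp: wp_rules exec_simps I_def ready_def eq_floor_iff D_insert)
      qed
    next
      case (4 t s')
      then show ?case by (simp add: I_def ready_def set_reg_def D_row)
    qed
  qed
qed

lemma wp_search_row: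
  assumes "ready s" "reg s found_reg = 0"
  shows "wp search_row s (\<lambda>t s'. t \<le> 2 + n * 7 \<and> ready s' \<and> agree_off {j_reg, found_reg} s s' \<and>
    (reg s' found_reg \<noteq> 0 \<longleftrightarrow> (\<exists>j<n. a (reg s i_reg) (reg s k_reg) - a (reg s r_reg) (reg s k_reg)
      \<le> \<lfloor>a (reg s i_reg) j - a (reg s r_reg) j\<rfloor>)))"
  unfolding search_row_def
proof (rule wp_for_upto[where N = n and T = 5 and I = "\<lambda>c s'. ready s' \<and>
      agree_off {j_reg, found_reg} s s' \<and> reg s' j_reg = c \<and>
      (reg s' found_reg \<noteq> 0 \<longleftrightarrow> (\<exists>j<c. a (reg s i_reg) (reg s k_reg) - a (reg s r_reg) (reg s k_reg)
        \<le> \<lfloor>a (reg s i_reg) j - a (reg s r_reg) j\<rfloor>))"], goal_cases)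
  case (3 c s')
  then have [simp]: "reg s' i_reg = reg s i_reg" "reg s' r_reg = reg s r_reg"
      "reg s' k_reg = reg s k_reg"
    by (auto simp: agree_off_def)
  show ?case
    using 3 by (auto simp: wp_rules exec_simps ready_def agree_off_def less_Suc_eq not_less)
qed (use assms in \<open>auto simp: ready_def agree_off_def set_reg_def\<close>)

lemma wp_test_column:
  assumes "ready s" "reg s all_reg \<noteq> 0"
  shows "wp test_column s (\<lambda>t s'. t \<le> 2 + m * (n * 7 + 7) \<and> ready s' \<and>
    agree_off {i_reg, j_reg, found_reg, all_reg} s s' \<and>
    (reg s' all_reg \<noteq> 0 \<longleftrightarrow> pivot_column m n a (reg s r_reg) (reg s k_reg)))"
  unfolding test_column_def
\<comment> \<open>\<open>pivot_column c\<close> says that the rows below \<open>c\<close> have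
  passed. The body costs 1 for clearing the flag, \<open>2 + n * 7\<close> for the search and at
  most 2 for the branch.\<close>
proof (rule wp_for_upto[where N = m and T = "n * 7 + 5" and I = "\<lambda>c s'. ready s' \<and>
      agree_off {i_reg, j_reg, found_reg, all_reg} s s' \<and> reg s' i_reg = c \<and>
      (reg s' all_reg \<noteq> 0 \<longleftrightarrow> pivot_column c n a (reg s r_reg) (reg s k_reg))"], goal_cases)
  case (3 c s')
  then have *: "reg s' r_reg = reg s r_reg" "reg s' k_reg = reg s k_reg" "reg s' i_reg = c"
    by (auto simp: agree_off_def)
  have "ready (set_reg s' found_reg 0)" "reg (set_reg s' found_reg 0) found_reg = 0"
    using 3 by (simp_all add: ready_def set_reg_def)
  note search = wp_search_row[OF this]
  show ?case
    unfolding wp_Seq wp_Instr exec.simps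
  proof (rule wp_mono[OF search], goal_cases)
    case (1 t s'')
    then have "ready s''" "reg s'' i_reg = c" "t \<le> 2 + n * 7"
        "agree_off {i_reg, j_reg, found_reg, all_reg} s s''"
        "reg s'' all_reg = reg s' all_reg"
        "reg s'' found_reg \<noteq> 0 \<longleftrightarrow> (\<exists>j<n. a c (reg s k_reg) - a (reg s r_reg) (reg s k_reg)
          \<le> \<lfloor>a c j - a (reg s r_reg) j\<rfloor>)"
      using 3 * by (auto simp: agree_off_def set_reg_def)
    then show ?case
      using 3 by (auto simp: wp_rules exec_simps ready_def agree_off_def pivot_column_def less_Suc_eq)
  qed
next
  case (1 c s')
  then show ?case by (simp add: ready_def)
next
  case 2
  with assms show ?case by (simp add: ready_def agree_off_def set_reg_def pivot_column_def)
next
  case (4 t s')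
  then show ?case by (simp add: ac_simps)
qed

lemma wp_find_pivot:
  assumes "ready s" "reg s res_reg = 0"
  shows "wp find_pivot s (\<lambda>t s'. t \<le> 2 + n * (m * (n * 7 + 7) + 6 + 2) \<and> ready s' \<and>
    reg s' r_reg = reg s r_reg \<and>
    (if reg s' res_reg = 0 then \<not> (\<exists>k<n. pivot_column m n a (reg s r_reg) k)
     else reg s' pivot_reg < n \<and> pivot_column m n a (reg s r_reg) (reg s' pivot_reg)))"
  unfolding find_pivot_def
proof (rule wp_for_upto[where N = n and T = "m * (n * 7 + 7) + 6" and I = "\<lambda>c s'. ready s' \<and>
      reg s' r_reg = reg s r_reg \<and> reg s' k_reg = c \<and>
      (if reg s' res_reg = 0 then \<not> (\<exists>k<c. pivot_column m n a (reg s r_reg) k)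
       else reg s' pivot_reg < c \<and> pivot_column m n a (reg s r_reg) (reg s' pivot_reg))"], goal_cases)
  case (3 c s')
  have "ready (set_reg s' all_reg 1)" "reg (set_reg s' all_reg 1) all_reg \<noteq> 0"
    using 3 by (simp_all add: ready_def set_reg_def)
  note test = wp_test_column[OF this]
  show ?case
    unfolding wp_Seq wp_Instr exec.simps
  proof (rule wp_mono[OF test], goal_cases)
    case (1 t s'')
    then have "ready s''" "t \<le> 2 + m * (n * 7 + 7)" "reg s'' k_reg = c"
        "reg s'' r_reg = reg s r_reg" "reg s'' res_reg = reg s' res_reg"
        "reg s'' pivot_reg = reg s' pivot_reg"
        "reg s'' all_reg \<noteq> 0 \<longleftrightarrow> pivot_column m n a (reg s r_reg) c"
      using 3 by (auto simp: agree_off_def set_reg_def)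
    then show ?case
      using 3 by (auto simp: wp_rules exec_simps ready_def less_Suc_eq)
  qed
next
  case (1 c s')
  then show ?case by (simp add: ready_def)
next
  case 2
  with assms show ?case by (simp add: ready_def set_reg_def)
next
  case (4 t s')
  then show ?case by blast
qed

lemma wp_write_output:
  assumes "ready s"
  shows "wp write_output s (\<lambda>t s'. t \<le> 2 + n * 8 \<and> reg s' res_reg = reg s res_reg \<and>
    (\<forall>j<n. mem s' (1, 0, j) =
      (let q = if j = reg s pivot_reg then reg s r_reg else if reg s r_reg = 0 then 1 else 0
       in of_int \<lfloor>a q j - a (reg s r_reg) j\<rfloor> - a q j)))"
  unfolding write_output_def
proof (rule wp_for_upto[where N = n and T = 6 and I = "\<lambda>c s'. ready s' \<and>
      agree_off {j_reg, q_reg} s s' \<and> reg s' j_reg = c \<and>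
      (\<forall>j<c. mem s' (1, 0, j) =
        (let q = if j = reg s pivot_reg then reg s r_reg else if reg s r_reg = 0 then 1 else 0
         in of_int \<lfloor>a q j - a (reg s r_reg) j\<rfloor> - a q j))"], goal_cases)
  case (3 c s')
  then have [simp]: "reg s' r_reg = reg s r_reg" "reg s' pivot_reg = reg s pivot_reg"
    by (auto simp: agree_off_def)
  show ?case
    using 3
    by (simp add: wp_rules exec_simps ready_def agree_off_def less_Suc_eq all_conj_distrib Let_def)
qed (use assms in \<open>auto simp: ready_def agree_off_def set_reg_def\<close>)

end

text \<open>For positive \<open>m\<close> and \<open>n\<close> each of 1, \<open>m\<close>,
  \<open>n\<close> and \<open>m * n\<close> is at most \<open>m * n\<^sup>2\<close>; the
  coefficients add up to 49, so 60 leaves room.\<close>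

lemma time_bound:
  fixes m n :: nat
  assumes "m \<ge> 1" "n \<ge> 1"
    and "t \<le> 1 + (2 + m * (2 + n * 8 + 2)) + (2 + n * (m * (n * 7 + 7) + 6 + 2)) + (2 + n * 8)"
  shows "t \<le> 60 * (m * n\<^sup>2)"
proof -
  let ?p = "m * n\<^sup>2"
  have n2: "1 \<le> n\<^sup>2" "n \<le> n\<^sup>2" using assms(2) by (simp_all add: power2_eq_square)
  have "1 \<le> ?p" "n \<le> ?p" "m \<le> ?p" "m * n \<le> ?p"
    using mult_le_mono[OF assms(1) n2(1)] mult_le_mono[OF assms(1) n2(2)]
      mult_le_mono2[OF n2(1), of m] mult_le_mono2[OF n2(2), of m]
    by simp_all
  moreover have "t \<le> 7 + 4 * m + 15 * (m * n) + 7 * ?p + 16 * n"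
    using assms(3) by (simp add: algebra_simps power2_eq_square)
  ultimately show ?thesis by linarith
qed

theorem solver_correct:
  assumes n: "n \<ge> 1" and A: "A \<in> carrier_mat m n" and acu: "almost_column_uniform A"
  shows "\<exists>t s. run solver (input_state A) t s \<and> t \<le> 60 * (m * n\<^sup>2) \<and>
    (if announces_solution s then integer_vec (A \<otimes>\<^sub>m\<^sub>p output_vec n s)
     else \<not> (\<exists>x\<in>carrier_vec n. integer_vec (A \<otimes>\<^sub>m\<^sub>p x)))"
proof -
  \<comment> \<open>Taken from memory rather than from \<open>A\<close>, this function satisfies
    \<open>ready\<close> at all indices and agrees with \<open>A\<close> within its
    dimensions.\<close>
  define a where "a i j = mem (input_state A) (0, i, j)" for i j
  have a: "a i j = A $$ (i, j)" if "i < m" "j < n" for i j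
    using A that by (simp add: a_def input_state_def)
  interpret solver_run m n a .
  have m: "m \<ge> 2" and "\<exists>r0<m. column_uniform (del_row A r0)"
    using acu A by (auto simp: almost_column_uniform_def)
  then obtain r0 where "uniform_off m n (\<lambda>i j. A $$ (i, j)) r0"
    using column_uniform_del_row[OF A] by blast
  then have r0: "uniform_off m n a r0"
    by (simp add: uniform_off_def a)
  have int_iff: "integer_vec (A \<otimes>\<^sub>m\<^sub>p x) \<longleftrightarrow>
      (\<forall>i<m. Max ((\<lambda>j. a i j + x $ j) ` {..<n}) \<in> \<int>)" for x
    unfolding integer_vec_mp_mult[OF A]
    by (intro all_cong arg_cong[where f = "\<lambda>S. Max S \<in> \<int>"] image_cong) (auto simp: a)
  let ?s = "set_reg (input_state A) one_reg 1"
  have s: "ready ?s" "reg ?s seen_reg = 0" "reg ?s r_reg = 0" "reg ?s res_reg = 0"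
    using A by (auto simp: ready_def set_reg_def input_state_def a_def)
  obtain t1 s1 where s1: "run find_row ?s t1 s1" "t1 \<le> 2 + m * (2 + n * 8 + 2)" "ready s1"
      "reg s1 res_reg = 0"
      "scan_inv {i. i < m \<and> (\<exists>j<n. a i j - a 0 j \<notin> \<int>)} (reg s1 seen_reg) (reg s1 r_reg)"
    using wp_find_row[OF s(1-3)] s(4) unfolding wp_def by auto
  define r where "r = reg s1 r_reg"
  have r: "r < m" "uniform_off m n a r"
    using scan_inv_uniform_off[OF s1(5) r0] m by (auto simp: r_def)
  obtain t2 s2 where s2: "run find_pivot s1 t2 s2" "t2 \<le> 2 + n * (m * (n * 7 + 7) + 6 + 2)" "ready s2"
      "reg s2 r_reg = r"
      "if reg s2 res_reg = 0 then \<not> (\<exists>k<n. pivot_column m n a r k)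
       else reg s2 pivot_reg < n \<and> pivot_column m n a r (reg s2 pivot_reg)"
    using wp_find_pivot[OF s1(3,4)] unfolding wp_def r_def by blast
  obtain t3 s3 where s3: "run write_output s2 t3 s3" "t3 \<le> 2 + n * 8"
      "reg s3 res_reg = reg s2 res_reg"
      "\<forall>j<n. mem s3 (1, 0, j) =
        (let q = if j = reg s2 pivot_reg then r else if r = 0 then 1 else 0
         in of_int \<lfloor>a q j - a r j\<rfloor> - a q j)"
    using wp_write_output[OF s2(3)] unfolding wp_def s2(4) by blast
  have "run (Instr (ISet one_reg 1)) (input_state A) 1 ?s"
    using run_Instr[of "ISet one_reg 1"] by simp
  from run_Seq[OF this run_Seq[OF s1(1) run_Seq[OF s2(1) s3(1)]]]
  have run: "run solver (input_state A) (1 + (t1 + (t2 + t3))) s3"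
    unfolding solver_def .
  have time: "1 + (t1 + (t2 + t3)) \<le> 60 * (m * n\<^sup>2)"
    using s1(2) s2(2) s3(2) m n by (intro time_bound) auto
  have "if announces_solution s3 then integer_vec (A \<otimes>\<^sub>m\<^sub>p output_vec n s3)
     else \<not> (\<exists>x\<in>carrier_vec n. integer_vec (A \<otimes>\<^sub>m\<^sub>p x))"
  proof (cases "announces_solution s3")
    case True
    \<comment> \<open>\<open>?q\<close> is the reference row chosen by the program; row 1 exists
      because \<open>m \<ge> 2\<close>.\<close>
    let ?k = "reg s2 pivot_reg" and ?q = "if r = 0 then 1 else 0 :: nat"
    have k: "?k < n" "pivot_column m n a r ?k"
      using True s2(5) s3(3) by (auto simp: announces_solution_def)
    have q: "?q < m" "?q \<noteq> r" using m by auto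
    have x_pivot: "output_vec n s3 $ ?k = - a r ?k"
      using s3(4) k(1) by (simp add: output_vec_def)
    have x_other: "output_vec n s3 $ j = of_int \<lfloor>a ?q j - a r j\<rfloor> - a ?q j"
      if "j < n" "j \<noteq> ?k" for j
      using s3(4) that by (simp add: output_vec_def)
    interpret rounding m n a "\<lambda>j. output_vec n s3 $ j" r ?k ?q
      by (rule rounding.intro; (fact r k q x_pivot)?) (rule x_other)
    show ?thesis using True Max_integer int_iff by simp
  next
    case False
    then have "\<not> (\<exists>k<n. pivot_column m n a r k)"
      using s2(5) s3(3) by (simp add: announces_solution_def)
    \<comment> \<open>An integer image would yield a pivot column for the row \<open>r\<close> found
      by the scan.\<close>
    then have "\<not> integer_vec (A \<otimes>\<^sub>m\<^sub>p x)" for x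
      using pivot_column_exists[OF n r(1), of a "\<lambda>j. x $ j"] int_iff by blast
    with False show ?thesis by simp
  qed
  with run time show ?thesis by blast
qed

theorem mainTheorem2:
  shows
    "(\<forall>(m::nat) (n::nat) (A::real mat) (Abar::real mat) (f::real vec)
        (B::nat \<Rightarrow> real mat) (F::nat \<Rightarrow> real vec).
        m \<ge> 2 \<longrightarrow> n \<ge> 2 \<longrightarrow> A \<in> carrier_mat m n \<longrightarrow>
        Abar = del_row A (m - 1) \<longrightarrow>
        column_uniform Abar \<longrightarrow>
        (\<forall>j<n. \<not> uniform_vec (col A j)) \<longrightarrow>
        (\<forall>j<n. A $$ (m - 1, j) = 0) \<longrightarrow>
        f \<in> carrier_vec n \<longrightarrow> (\<forall>j<n. \<forall>i<m - 1. frac (A $$ (i, j)) = f $ j) \<longrightarrow>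
        B = (\<lambda>k. del_col Abar k) \<longrightarrow> F = (\<lambda>k. del_entry f k) \<longrightarrow>
        ((\<exists>x\<in>carrier_vec n. integer_vec (A \<otimes>\<^sub>m\<^sub>p x)) \<longleftrightarrow>
           (\<exists>k<n. B k \<otimes>\<^sub>m\<^sub>p (- F k) \<ge> col Abar k)) \<and>
        (\<forall>k<n. B k \<otimes>\<^sub>m\<^sub>p (- F k) \<ge> col Abar k \<longrightarrow>
           (let x = - vec n (\<lambda>j. if j = k then 0 else f $ j) in
              integer_vec (A \<otimes>\<^sub>m\<^sub>p x) \<and>
              A \<otimes>\<^sub>m\<^sub>p x = (B k \<otimes>\<^sub>m\<^sub>p (- F k)) @\<^sub>v vec 1 (\<lambda>_. 0))))
     \<and>
     (\<exists>(P::program) (C::nat). \<forall>(m::nat) (n::nat) (A::real mat).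
        n \<ge> 1 \<longrightarrow> A \<in> carrier_mat m n \<longrightarrow> almost_column_uniform A \<longrightarrow>
        (\<exists>t s. run P (input_state A) t s \<and> t \<le> C * (m * n^2) \<and>
           (if announces_solution s
            then integer_vec (A \<otimes>\<^sub>m\<^sub>p output_vec n s)
            else \<not> (\<exists>x\<in>carrier_vec n. integer_vec (A \<otimes>\<^sub>m\<^sub>p x)))))"
proof (rule conjI, goal_cases)
  case 1
  show ?case
  proof (intro allI impI conjI, goal_cases)
    case (1 m n A Abar f B F)
    have f: "frac (A $$ (i, j)) = f $ j" if "i < m - 1" "j < n" for i j
      using 1(9) that by blast
    show ?case
      unfolding 1(4,10,11)
      by (rule last_row_zero_criterion(1)[OF 1(1-3) 1(5)[unfolded 1(4)] 1(6,7)[rule_format] 1(8) f])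
  next
    case (2 m n A Abar f B F k)
    have f: "frac (A $$ (i, j)) = f $ j" if "i < m - 1" "j < n" for i j
      using 2(9) that by blast
    show ?case
      unfolding Let_def 2(4,10,11)
      by (rule last_row_zero_criterion(2)[OF 2(1-3) 2(5)[unfolded 2(4)] 2(6,7)[rule_format] 2(8) f
        2(12) 2(13)[unfolded 2(4,10,11)] refl])
  qed
next
  case 2
  show ?case
    by (rule exI[of _ solver], rule exI[of _ 60], intro allI impI) (rule solver_correct)
qed

end
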